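(* Let $L$ be a Tonelli Lagrangian on $\mathbb T^d$. For every mesh size $h>0$ and every time step $\tau>0$ there exist $\bar L(h,\tau)\in\mathbb R$ and $u_{h,\tau}:\mathcal G_h\to\mathbb R$ such that $$u_{h,\tau}(x_j)+\tau\bar L(h,\tau)=(T_{h,\tau}u_{h,\tau})(x_j)\qquad\text{for all }x_j\in\mathcal G_h .$$ Moreover, the constant $\bar L(h,\tau)$ is uniquely determined (i.e. it is the same for every pair solving this equation) and satisfies $$\inf_{\mathbb T^d\times\mathbb R^d}L\le\bar L(h,\tau)\le\max_{x\in\mathbb T^d}L(x,0).$$
   Context: $\mathbb T^d=\mathbb R^d/\mathbb Z^d$. $H\in C^2(\mathbb T^d\times\mathbb R^d)$ is a Tonelli Hamiltonian: $D^2_{pp}H(x,p)>0$ everywhere and $H$ is superlinear in $p$. The Tonelli Lagrangian is $L(x,v)=\sup_{p\in\mathbb R^d}\{p\cdot v-H(x,p)\}$; it is of class $C^2$, strictly convex in $v$, and superlinear: for every $K>0$ there is $C(K)\in\mathbb R$ with $L(x,v)\ge K|v|-C(K)$ for all $(x,v)$. Mesh sizes are always of the form $h=1/N$ with $N\ge1$ an integer. The grid is $\mathcal G_h=\{x_i=ih \bmod \mathbb Z^d: i\in\{0,\dots,N-1\}^d\}$, and each grid point is identified with its representative in $[0,1)^d$. The fully-discrete Lax–Oleinik operator acts on $u_h:\mathcal G_h\to\mathbb R$ by $$(T_{h,\tau}u_h)(x_j)=\min_{x_i\in\mathcal G_h,\ \ell\in\mathbb Z^d}\Big\{u_h(x_i)+\tau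 L\Big(x_i,\frac{x_j+\ell-x_i}{\tau}\Big)\Big\},\qquad x_j\in\mathcal G_h;$$ the minimum is attained. *)

theory Defs
  imports "HOL-Analysis.Analysis"
begin

text \<open>
  Functions on the torus are represented by functions on \<open>real ^ 'n\<close> that are periodic with
  respect to the integer vectors; the dimension is \<open>d = CARD('n) \<ge> 1\<close>.
\<close>

definition int_vectors :: "(real ^ 'n) set" where
  "int_vectors = {l. \<forall>k. l $ k \<in> \<int>}"

definition has_C2_derivatives ::
  "('a::real_normed_vector \<Rightarrow> real) \<Rightarrow> ('a \<Rightarrow> 'a \<Rightarrow>\<^sub>L real) \<Rightarrow> ('a \<Rightarrow> 'a \<Rightarrow>\<^sub>L ('a \<Rightarrow>\<^sub>L real)) \<Rightarrow> bool"
where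
  "has_C2_derivatives f Df D2f \<longleftrightarrow>
     (\<forall>z. (f has_derivative blinfun_apply (Df z)) (at z)) \<and>
     (\<forall>z. (Df has_derivative blinfun_apply (D2f z)) (at z)) \<and>
     continuous_on UNIV D2f"

text \<open>
  The second derivative of \<open>H\<close> restricted to directions \<open>(0, w)\<close> is the
  quadratic form of the partial Hessian in \<open>p\<close>. Superlinearity is uniform in \<open>x\<close>.
\<close>

definition tonelli_hamiltonian :: "((real ^ 'n) \<times> (real ^ 'n) \<Rightarrow> real) \<Rightarrow> bool" where
  "tonelli_hamiltonian H \<longleftrightarrow>
     (\<forall>x p. \<forall>l\<in>int_vectors. H (x + l, p) = H (x, p)) \<and>
     (\<exists>DH D2H. has_C2_derivatives H DH D2H \<and>
        (\<forall>x p w. w \<noteq> 0 \<longrightarrow> blinfun_apply (blinfun_apply (D2H (x, p)) (0, w)) (0, w) > 0)) \<and>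
     (\<forall>K>0. \<exists>C. \<forall>x p. H (x, p) \<ge> K * norm p - C)"

definition lagrangian :: "((real ^ 'n) \<times> (real ^ 'n) \<Rightarrow> real) \<Rightarrow> real ^ 'n \<Rightarrow> real ^ 'n \<Rightarrow> real" where
  "lagrangian H x v = (SUP p. p \<bullet> v - H (x, p))"

definition tonelli_lagrangian :: "(real ^ 'n \<Rightarrow> real ^ 'n \<Rightarrow> real) \<Rightarrow> bool" where
  "tonelli_lagrangian L \<longleftrightarrow> (\<exists>H. tonelli_hamiltonian H \<and> L = lagrangian H)"

definition mesh_size :: "real \<Rightarrow> bool" where
  "mesh_size h \<longleftrightarrow> (\<exists>N::nat. N \<ge> 1 \<and> h = 1 / real N)"

text \<open>
  Grid points are given by their representatives in \<open>[0, 1)\<^sup>d\<close>: for \<open>h = 1 / N\<close> the condition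
  \<open>i * h < 1\<close> says \<open>i < N\<close>.
\<close>

definition grid :: "real \<Rightarrow> (real ^ 'n) set" where
  "grid h = {x. \<forall>k. \<exists>i::nat. real i * h < 1 \<and> x $ k = real i * h}"

text \<open>
  Only the values of \<open>u\<close> on the grid enter. The infimum is a minimum for a Tonelli Lagrangian,
  see \<open>lax_oleinik_attained\<close> below.
\<close>

definition lax_oleinik ::
  "(real ^ 'n \<Rightarrow> real ^ 'n \<Rightarrow> real) \<Rightarrow> real \<Rightarrow> real \<Rightarrow> (real ^ 'n \<Rightarrow> real) \<Rightarrow> real ^ 'n \<Rightarrow> real"
where
  "lax_oleinik L h \<tau> u y =
     (INF (x, l) \<in> grid h \<times> int_vectors. u x + \<tau> * L x ((y + l - x) /\<^sub>R \<tau>))"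

definition discrete_solution ::
  "(real ^ 'n \<Rightarrow> real ^ 'n \<Rightarrow> real) \<Rightarrow> real \<Rightarrow> real \<Rightarrow> real \<Rightarrow> (real ^ 'n \<Rightarrow> real) \<Rightarrow> bool"
where
  "discrete_solution L h \<tau> c u \<longleftrightarrow> (\<forall>y\<in>grid h. u y + \<tau> * c = lax_oleinik L h \<tau> u y)"

text \<open>
  The remaining facts show that the suprema and infima occurring in the definitions and in the
  theorem are over suitably bounded sets, and that those written as maximum or minimum in the
  mathematics are attained.
\<close>

lemma torus_representative:
  fixes x :: "real ^ 'n"
  obtains y l where "x = y + l" "y \<in> cbox 0 (\<chi> k. 1)" "l \<in> int_vectors"
proof -
  have "x = (\<chi> k. frac (x $ k)) + (\<chi> k. of_int \<lfloor>x $ k\<rfloor>)"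
    by (simp add: vec_eq_iff frac_def)
  moreover have "(\<chi> k. frac (x $ k)) \<in> cbox 0 (\<chi> k. 1)"
    by (auto simp: mem_box_cart frac_ge_0 less_imp_le[OF frac_lt_1])
  moreover have "(\<chi> k. of_int \<lfloor>x $ k\<rfloor>) \<in> int_vectors"
    by (simp add: int_vectors_def)
  ultimately show thesis by (rule that)
qed

context
  fixes H :: "(real ^ 'n) \<times> (real ^ 'n) \<Rightarrow> real"
  assumes H: "tonelli_hamiltonian H"
begin

lemma hamiltonian_continuous: "continuous_on UNIV H"
  using H unfolding tonelli_hamiltonian_def has_C2_derivatives_def
  by (meson has_derivative_continuous continuous_at_imp_continuous_on)

lemma hamiltonian_periodic: "l \<in> int_vectors \<Longrightarrow> H (x + l, p) = H (x, p)"
  using H unfolding tonelli_hamiltonian_def by blast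

lemma hamiltonian_superlinear:
  assumes "K > 0" obtains C where "\<And>x p. H (x, p) \<ge> K * norm p - C"
  using H assms unfolding tonelli_hamiltonian_def by blast

lemma hamiltonian_bounded:
  obtains M where "\<And>x p. norm p \<le> K \<Longrightarrow> H (x, p) \<le> M"
proof -
  have "compact (cbox 0 (\<chi> k. 1) \<times> cball 0 K :: ((real ^ 'n) \<times> (real ^ 'n)) set)"
    by (intro compact_Times compact_cbox compact_cball)
  then have "compact (H ` (cbox 0 (\<chi> k. 1) \<times> cball 0 K))"
    by (intro compact_continuous_image continuous_on_subset[OF hamiltonian_continuous]) auto
  then obtain M where M: "\<And>z. z \<in> cbox 0 (\<chi> k. 1) \<times> cball 0 K \<Longrightarrow> H z \<le> M"
    by (meson bdd_above_def bounded_imp_bdd_above compact_imp_bounded image_eqI)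
  show thesis
  proof (rule that)
    fix x p :: "real ^ 'n" assume "norm p \<le> K"
    obtain y l where "x = y + l" "y \<in> cbox 0 (\<chi> k. 1)" "l \<in> int_vectors"
      by (rule torus_representative)
    with M[of "(y, p)"] \<open>norm p \<le> K\<close> show "H (x, p) \<le> M"
      by (simp add: hamiltonian_periodic)
  qed
qed

lemma lagrangian_bdd_above: "bdd_above (range (\<lambda>p. p \<bullet> v - H (x, p)))"
proof -
  obtain C where C: "\<And>x p. H (x, p) \<ge> (norm v + 1) * norm p - C"
    using hamiltonian_superlinear[of "norm v + 1"] by (smt (verit) norm_ge_zero)
  have "p \<bullet> v - H (x, p) \<le> C" for p
  proof -
    have "p \<bullet> v \<le> norm p * norm v" by (rule norm_cauchy_schwarz)
    moreover have "(norm v + 1) * norm p = norm p * norm v + norm p"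
      by (simp add: algebra_simps)
    ultimately show ?thesis using C[of p x] norm_ge_zero[of p] by linarith
  qed
  then show ?thesis by (auto intro!: bdd_aboveI[of _ C])
qed

lemma lagrangian_upper: "p \<bullet> v - H (x, p) \<le> lagrangian H x v"
  unfolding lagrangian_def by (rule cSUP_upper[OF UNIV_I lagrangian_bdd_above])

lemma lagrangian_superlinear:
  assumes "K > 0" obtains C where "\<And>x v. lagrangian H x v \<ge> K * norm v - C"
proof -
  obtain M where M: "\<And>x p. norm p \<le> K \<Longrightarrow> H (x, p) \<le> M"
    using hamiltonian_bounded[of K] by blast
  show thesis
  proof (rule that)
    fix x v :: "real ^ 'n"
    let ?p = "K *\<^sub>R sgn v"
    have "norm ?p \<le> K" using \<open>K > 0\<close> by (simp add: norm_sgn)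
    then have "H (x, ?p) \<le> M" by (rule M)
    moreover have "?p \<bullet> v = K * norm v"
      by (cases "v = 0") (simp_all add: sgn_div_norm dot_square_norm power2_eq_square)
    ultimately show "K * norm v - M \<le> lagrangian H x v"
      using lagrangian_upper[of ?p v x] by linarith
  qed
qed

lemma lagrangian_zero_max: "\<exists>x0. \<forall>x. lagrangian H x 0 \<le> lagrangian H x0 0"
proof -
  obtain C where C: "\<And>x p. H (x, p) \<ge> 1 * norm p - C"
    using hamiltonian_superlinear[of 1] by (metis zero_less_one)
  define R where "R = \<bar>H (0, 0)\<bar> + \<bar>C\<bar>"
  have R: "R \<ge> 0" by (simp add: R_def)
  have "compact (cbox 0 (\<chi> k. 1) \<times> cball 0 R :: ((real ^ 'n) \<times> (real ^ 'n)) set)"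
    by (intro compact_Times compact_cbox compact_cball)
  moreover have z: "(0, 0) \<in> (cbox 0 (\<chi> k. 1) \<times> cball 0 R :: ((real ^ 'n) \<times> (real ^ 'n)) set)"
    using R by (auto simp: mem_box_cart)
  ultimately obtain z0 where z0: "\<And>z. z \<in> cbox 0 (\<chi> k. 1) \<times> cball 0 R \<Longrightarrow> H z0 \<le> H z"
    using continuous_attains_inf[OF _ _ continuous_on_subset[OF hamiltonian_continuous]]
    by (metis (no_types, lifting) empty_iff subset_UNIV)
  have min: "H z0 \<le> H (x, p)" for x p
  proof (cases "norm p \<le> R")
    case True
    obtain y l where "x = y + l" "y \<in> cbox 0 (\<chi> k. 1)" "l \<in> int_vectors"
      by (rule torus_representative)
    with z0[of "(y, p)"] True show ?thesis by (simp add: hamiltonian_periodic)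
  next
    case False
    then have "H (x, p) \<ge> H (0, 0)" using C[of p x] by (simp add: R_def)
    with z0[OF z] show ?thesis by linarith
  qed
  have "lagrangian H x 0 \<le> lagrangian H (fst z0) 0" for x
  proof -
    have "lagrangian H x 0 \<le> - H z0"
      unfolding lagrangian_def by (rule cSUP_least) (use min in auto)
    also have "\<dots> \<le> lagrangian H (fst z0) 0"
      using lagrangian_upper[of "snd z0" 0 "fst z0"] by simp
    finally show ?thesis .
  qed
  then show ?thesis by blast
qed

end

lemma tonelli_lagrangian_bdd_below:
  assumes "tonelli_lagrangian L"
  shows "bdd_below (range (\<lambda>(x, v). L x v))"
proof -
  obtain H where H: "tonelli_hamiltonian H" and L: "L = lagrangian H"
    using assms unfolding tonelli_lagrangian_def by blast
  obtain C where "\<And>x v. L x v \<ge> 1 * norm v - C"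
    using lagrangian_superlinear[OF H zero_less_one] L by metis
  then have "- C \<le> L x v" for x v
    by (smt (verit) norm_ge_zero mult_1)
  then show ?thesis by (auto intro!: bdd_belowI[of _ "- C"])
qed

lemma tonelli_lagrangian_zero_max:
  assumes "tonelli_lagrangian L"
  shows "\<exists>x0. \<forall>x. L x 0 \<le> L x0 0"
  using assms lagrangian_zero_max unfolding tonelli_lagrangian_def by blast

lemma finite_vectors_with_components_in:
  assumes "finite S" shows "finite {x :: real ^ 'n. \<forall>k. x $ k \<in> S}"
proof -
  have "{x :: real ^ 'n. \<forall>k. x $ k \<in> S} \<subseteq> vec_lambda ` (\<Pi>\<^sub>E k\<in>UNIV. S)"
    by (auto intro!: image_eqI[where x="vec_nth _"])
  then show ?thesis
    by (rule finite_subset) (intro finite_imageI finite_PiE assms finite)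
qed

lemma finite_int_vectors_bounded:
  "finite {l \<in> int_vectors. norm (l :: real ^ 'n) \<le> R}"
proof -
  have "{a \<in> \<int>. \<bar>a\<bar> \<le> R} \<subseteq> real_of_int ` {- \<lceil>R\<rceil>..\<lceil>R\<rceil>}"
  proof
    fix a assume a: "a \<in> {a \<in> \<int>. \<bar>a\<bar> \<le> R}"
    then obtain b where "a = of_int b" by (auto elim: Ints_cases)
    with a show "a \<in> real_of_int ` {- \<lceil>R\<rceil>..\<lceil>R\<rceil>}"
      by (auto simp: abs_le_iff le_floor_iff minus_le_iff[of "\<lceil>R\<rceil>"] intro!: imageI) linarith+
  qed
  then have "finite {a \<in> \<int>. \<bar>a :: real\<bar> \<le> R}" by (rule finite_subset) simp
  then have "finite {l :: real ^ 'n. \<forall>k. l $ k \<in> {a \<in> \<int>. \<bar>a\<bar> \<le> R}}"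
    by (rule finite_vectors_with_components_in)
  then show ?thesis
    by (rule finite_subset[rotated])
       (auto simp: int_vectors_def intro: order_trans[OF component_le_norm_cart])
qed

lemma finite_grid:
  assumes "mesh_size h" shows "finite (grid h :: (real ^ 'n) set)"
proof -
  obtain N :: nat where N: "N \<ge> 1" "h = 1 / real N"
    using assms unfolding mesh_size_def by blast
  have "finite {x :: real ^ 'n. \<forall>k. x $ k \<in> (\<lambda>i. real i * h) ` {..<N}}"
    by (rule finite_vectors_with_components_in) simp
  moreover have "(real i * h < 1) = (i < N)" for i
    using N(1) unfolding N(2) by (simp add: field_simps)
  then have "grid h \<subseteq> {x :: real ^ 'n. \<forall>k. x $ k \<in> (\<lambda>i. real i * h) ` {..<N}}"
    unfolding grid_def by auto
  ultimately show ?thesis by (rule finite_subset[rotated])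
qed

lemma lax_oleinik_attained:
  fixes L :: "real ^ 'n \<Rightarrow> real ^ 'n \<Rightarrow> real"
  assumes "tonelli_lagrangian L" "mesh_size h" "\<tau> > 0"
  shows "\<exists>x0\<in>grid h. \<exists>l0\<in>int_vectors.
    lax_oleinik L h \<tau> u y = u x0 + \<tau> * L x0 ((y + l0 - x0) /\<^sub>R \<tau>) \<and>
    (\<forall>x\<in>grid h. \<forall>l\<in>int_vectors.
      u x0 + \<tau> * L x0 ((y + l0 - x0) /\<^sub>R \<tau>) \<le> u x + \<tau> * L x ((y + l - x) /\<^sub>R \<tau>))"
proof -
  obtain H where H: "tonelli_hamiltonian H" and L: "L = lagrangian H"
    using assms(1) unfolding tonelli_lagrangian_def by blast
  obtain C where C: "\<And>x v. L x v \<ge> 1 * norm v - C"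
    using lagrangian_superlinear[OF H zero_less_one] L by metis
  define f where "f = (\<lambda>(x, l). u x + \<tau> * L x ((y + l - x) /\<^sub>R \<tau>))"
  define A :: "((real ^ 'n) \<times> (real ^ 'n)) set" where "A = grid h \<times> int_vectors"
  define R where "R = (\<lambda>x. f (0, 0) - u x + \<tau> * C + norm y + norm x)"
  have zero: "(0, 0) \<in> A"
    by (auto simp: A_def grid_def int_vectors_def intro!: exI[of _ "0::nat"])
  have bound: "norm l \<le> R x" if "f (x, l) \<le> f (0, 0)" for x l
  proof -
    have "\<tau> * (norm ((y + l - x) /\<^sub>R \<tau>) - C) \<le> \<tau> * L x ((y + l - x) /\<^sub>R \<tau>)"
      using C[of "(y + l - x) /\<^sub>R \<tau>" x] \<open>\<tau> > 0\<close> by (intro mult_left_mono) auto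
    moreover have "\<tau> * (norm ((y + l - x) /\<^sub>R \<tau>) - C) = norm (y + l - x) - \<tau> * C"
      using \<open>\<tau> > 0\<close> by (simp add: right_diff_distrib)
    moreover have "norm l \<le> norm (y + l - x) + norm y + norm x"
      using norm_triangle_ineq4[of "y + l - x" "y - x"] norm_triangle_ineq4[of y x]
      by (simp add: algebra_simps)
    ultimately show ?thesis using that by (simp add: f_def R_def)
  qed
  let ?S = "{z \<in> A. f z \<le> f (0, 0)}"
  have "?S \<subseteq> (SIGMA x:grid h. {l \<in> int_vectors. norm l \<le> R x})"
    using bound by (auto simp: A_def)
  then have fin: "finite ?S"
    by (rule finite_subset)
       (intro finite_SigmaI finite_grid finite_int_vectors_bounded assms)
  have ne: "?S \<noteq> {}" using zero by blast
  define z0 where "z0 = arg_min_on f ?S"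
  have z0: "z0 \<in> ?S" "\<And>z. z \<in> ?S \<Longrightarrow> f z0 \<le> f z"
    unfolding z0_def by (rule arg_min_if_finite(1)[OF fin ne], rule arg_min_least[OF fin ne])
  have min: "f z0 \<le> f z" if "z \<in> A" for z
    using z0 that by (cases "f z \<le> f (0, 0)") auto
  have "lax_oleinik L h \<tau> u y = f z0"
    unfolding lax_oleinik_def f_def[symmetric] A_def[symmetric]
    by (rule cInf_eq_minimum) (use z0 min in auto)
  with z0(1) min show ?thesis
    unfolding A_def f_def by (auto split: prod.splits)
qed

end

theory Submission
  imports Defs
begin

text \<open>
  On the finite grid the Lax--Oleinik operator is a min-plus matrix operator \<open>T\<close>, and the claim is
  the existence of an additive eigenvalue. Since all functions in the range of \<open>T\<close> have oscillation
  at most \<open>K\<close>, super- and subadditivity of the minima and maxima of \<open>T\<^sup>n 0\<close> give a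
  number \<open>\<mu>\<close> with \<open>\<bar>T\<^sup>n 0 - n \<mu>\<bar> \<le> K\<close>. As \<open>T\<close> commutes with infima and, on a finite
  set, with limits, the lower limit of \<open>T\<^sup>n 0 - n \<mu>\<close> is an eigenfunction. Comparing a subsolution
  with a supersolution where their difference is largest yields uniqueness of \<open>\<mu>\<close>.
\<close>

section \<open>Min-plus operators on a finite set\<close>

definition min_plus :: "'a set \<Rightarrow> ('a \<Rightarrow> 'a \<Rightarrow> real) \<Rightarrow> ('a \<Rightarrow> real) \<Rightarrow> 'a \<Rightarrow> real" where
  "min_plus G c u y = (MIN x\<in>G. u x + c x y)"

context
  fixes G :: "'a set" and c :: "'a \<Rightarrow> 'a \<Rightarrow> real"
  assumes finite_G: "finite G" and nonempty_G: "G \<noteq> {}"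
begin

lemma le_min_plus_iff: "a \<le> min_plus G c u y \<longleftrightarrow> (\<forall>x\<in>G. a \<le> u x + c x y)"
  unfolding min_plus_def using finite_G nonempty_G by (subst Min_ge_iff) auto

lemma min_plus_le: "x \<in> G \<Longrightarrow> min_plus G c u y \<le> u x + c x y"
  using le_min_plus_iff by blast

text \<open>Monotonicity and compatibility with added constants in one rule. Since \<open>k\<close>
  may be negative, using it in both directions gives exact commutation with constants.\<close>

lemma min_plus_mono_shift:
  assumes "\<And>x. x \<in> G \<Longrightarrow> u x \<le> u' x + k"
  shows "min_plus G c u y \<le> min_plus G c u' y + k"
proof -
  have "min_plus G c u y - k \<le> min_plus G c u' y"
    unfolding le_min_plus_iff using assms min_plus_le[of _ u y] by (smt (verit))
  then show ?thesis by simp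
qed

text \<open>At a point \<open>y\<close> where \<open>u - u'\<close> attains its maximum
  \<open>k\<close>, shifting gives \<open>u y + a\<close> \<le> \<open>min_plus G c u' y + k\<close>
  \<le> \<open>u' y + b + k\<close>, and the last term is \<open>u y + b\<close>.\<close>

lemma min_plus_comparison:
  assumes sub: "\<And>y. y \<in> G \<Longrightarrow> u y + a \<le> min_plus G c u y"
    and super: "\<And>y. y \<in> G \<Longrightarrow> min_plus G c u' y \<le> u' y + b"
  shows "a \<le> b"
proof -
  define k where "k = (MAX x\<in>G. u x - u' x)"
  have "k \<in> (\<lambda>x. u x - u' x) ` G"
    unfolding k_def using finite_G nonempty_G by (intro Max_in) auto
  then obtain y where y: "y \<in> G" "k = u y - u' y" by blast
  have "u x - u' x \<le> k" if "x \<in> G" for x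
    unfolding k_def using finite_G that by (intro Max_ge) auto
  then have "min_plus G c u y \<le> min_plus G c u' y + k"
    by (intro min_plus_mono_shift) (simp add: algebra_simps)
  with sub[OF y(1)] super[OF y(1)] y(2) show ?thesis by simp
qed

text \<open>Changing the end point alters every candidate \<open>u x + c x y\<close> by at most
  twice a bound on the costs. Hence \<open>K\<close> depends on \<open>c\<close> only and serves all
  \<open>u\<close> at once.\<close>

lemma min_plus_oscillation:
  obtains K where "K \<ge> 0"
    "\<And>u y z. y \<in> G \<Longrightarrow> z \<in> G \<Longrightarrow> min_plus G c u y \<le> min_plus G c u z + K"
proof -
  define C where "C = (\<Sum>x\<in>G. \<Sum>y\<in>G. \<bar>c x y\<bar>)"
  have C: "\<bar>c x y\<bar> \<le> C" if "x \<in> G" "y \<in> G" for x y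
  proof -
    have "\<bar>c x y\<bar> \<le> (\<Sum>y\<in>G. \<bar>c x y\<bar>)"
      using finite_G that by (intro member_le_sum) auto
    also have "\<dots> \<le> C"
      unfolding C_def using finite_G that
      by (intro member_le_sum[of x G "\<lambda>x. \<Sum>y\<in>G. \<bar>c x y\<bar>"]) (auto intro: sum_nonneg)
    finally show ?thesis .
  qed
  show thesis
  proof (rule that)
    show "2 * C \<ge> 0" by (simp add: C_def sum_nonneg)
    fix u y z assume "y \<in> G" "z \<in> G"
    have "min_plus G c u y - 2 * C \<le> min_plus G c u z"
      unfolding le_min_plus_iff
    proof
      fix x assume "x \<in> G"
      with min_plus_le[of x u y] C[of x y] C[of x z] \<open>y \<in> G\<close> \<open>z \<in> G\<close>
      show "min_plus G c u y - 2 * C \<le> u x + c x z" by linarith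
    qed
    then show "min_plus G c u y \<le> min_plus G c u z + 2 * C" by simp
  qed
qed

section \<open>Iterates, growth rate and eigenfunction\<close>

lemma min_plus_funpow_mono_shift:
  assumes "\<And>x. x \<in> G \<Longrightarrow> u x \<le> u' x + k" "y \<in> G"
  shows "(min_plus G c ^^ n) u y \<le> (min_plus G c ^^ n) u' y + k"
  using assms by (induction n arbitrary: y) (auto intro: min_plus_mono_shift)

lemma min_plus_tendsto:
  assumes "\<And>x. x \<in> G \<Longrightarrow> (\<lambda>n. w n x) \<longlonglongrightarrow> u x"
  shows "(\<lambda>n. min_plus G c (w n) y) \<longlonglongrightarrow> min_plus G c u y"
proof -
  have "(\<lambda>n. MIN x\<in>G. w n x + c x y) \<longlonglongrightarrow> (MIN x\<in>G. u x + c x y)"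
    using finite_G nonempty_G assms
  proof (induction rule: finite_ne_induct)
    case (insert x F)
    then have "(\<lambda>n. min (w n x + c x y) (MIN x\<in>F. w n x + c x y))
        \<longlonglongrightarrow> min (u x + c x y) (MIN x\<in>F. u x + c x y)"
      by (intro tendsto_min tendsto_add tendsto_const) auto
    with insert show ?case by simp
  qed (auto intro: tendsto_add)
  then show ?thesis unfolding min_plus_def .
qed

lemma min_plus_growth_rate:
  obtains \<mu> K where
    "\<And>n y. y \<in> G \<Longrightarrow> \<bar>(min_plus G c ^^ n) (\<lambda>_. 0) y - real n * \<mu>\<bar> \<le> K"
proof -
  define v where "v n = (min_plus G c ^^ n) (\<lambda>_. 0)" for n
  obtain K where K: "K \<ge> 0"
    "\<And>u y z. y \<in> G \<Longrightarrow> z \<in> G \<Longrightarrow> min_plus G c u y \<le> min_plus G c u z + K"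
    using min_plus_oscillation by blast
  \<comment> \<open>For \<open>n > 0\<close> the iterate lies in the range of the operator;
    \<open>v 0\<close> is constant, so \<open>K \<ge> 0\<close> suffices there.\<close>
  have osc: "v n y \<le> v n z + K" if "y \<in> G" "z \<in> G" for n y z
    using that K by (cases n) (auto simp: v_def)
  have v_add: "v (m + n) = (min_plus G c ^^ m) (v n)" for m n
    by (simp add: v_def funpow_add)
  \<comment> \<open>Superadditivity of the minima: a start at \<open>v n - b\<close>, which
    dominates the start at 0, shows that every block of \<open>n\<close> further steps gains at
    least \<open>b\<close>. The estimate \<open>upper\<close> is the mirror image for
    maxima.\<close>
  have lower: "real k * b \<le> v (k * n) y"
    if b: "\<And>y. y \<in> G \<Longrightarrow> b \<le> v n y" and "y \<in> G" for k n b y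
    using \<open>y \<in> G\<close>
  proof (induction k arbitrary: y)
    case (Suc k)
    have "v (k * n) y \<le> v (k * n + n) y + - b"
      unfolding v_add unfolding v_def[of "k * n"]
      by (rule min_plus_funpow_mono_shift) (use b Suc.prems in auto)
    with Suc show ?case by (auto simp: algebra_simps) (smt (verit))
  qed (simp add: v_def)
  have upper: "v (k * n) y \<le> real k * a"
    if a: "\<And>y. y \<in> G \<Longrightarrow> v n y \<le> a" and "y \<in> G" for k n a y
    using \<open>y \<in> G\<close>
  proof (induction k arbitrary: y)
    case (Suc k)
    have "v (k * n + n) y \<le> v (k * n) y + a"
      unfolding v_add unfolding v_def[of "k * n"]
      by (rule min_plus_funpow_mono_shift) (use a Suc.prems in auto)
    with Suc show ?case by (auto simp: algebra_simps) (smt (verit))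
  qed (simp add: v_def)
  \<comment> \<open>All average rates per step that are guaranteed from below by some iterate; the
    growth rate is the best of them.\<close>
  define B where "B = {b / real n | b n. n > 0 \<and> (\<forall>y\<in>G. b \<le> v n y)}"
  define \<mu> where "\<mu> = Sup B"
  obtain y0 where y0: "y0 \<in> G" using nonempty_G by blast
  \<comment> \<open>The two rates are compared at the common time \<open>n * m\<close>, read as
    \<open>n\<close> blocks of length \<open>m\<close> and as \<open>m\<close> blocks of length
    \<open>n\<close>.\<close>
  have B_le: "t \<le> a / real n" if "t \<in> B" "n > 0" "\<And>y. y \<in> G \<Longrightarrow> v n y \<le> a" for t a n
  proof -
    obtain b m where b: "t = b / real m" "m > 0" "\<And>y. y \<in> G \<Longrightarrow> b \<le> v m y"
      using \<open>t \<in> B\<close> unfolding B_def by blast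
    have "real n * b \<le> real m * a"
      using lower[OF b(3) y0, of n] upper[OF that(3) y0, of m] by (simp add: mult.commute)
    with b(2) \<open>n > 0\<close> show ?thesis unfolding b(1) by (simp add: field_simps)
  qed
  have osc_lower: "v n y - K \<le> v n z" if "y \<in> G" "z \<in> G" for n y z
    using osc[OF that, of n] by simp
  have B_ne: "B \<noteq> {}"
  proof -
    have "(v 1 y0 - K) / real 1 \<in> B"
      unfolding B_def using osc_lower y0 by (blast intro: zero_less_one)
    then show ?thesis by blast
  qed
  have B_bdd: "bdd_above B"
    by (rule bdd_aboveI) (use B_le[of _ 1] osc[OF _ y0] in auto)
  have "\<bar>v n y - real n * \<mu>\<bar> \<le> K" if y: "y \<in> G" for n y
  proof (cases "n = 0")
    case False
    \<comment> \<open>By the oscillation bound, \<open>v n y + K\<close> and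
      \<open>v n y - K\<close> enclose \<open>v n\<close> on all of \<open>G\<close>: the first
      gives an upper bound of \<open>B\<close>, the second an element of \<open>B\<close>.\<close>
    have "\<mu> \<le> (v n y + K) / real n"
      unfolding \<mu>_def using B_ne False osc[OF _ y] by (intro cSup_least B_le) auto
    moreover have "(v n y - K) / real n \<in> B"
      unfolding B_def using osc_lower[OF y] False by blast
    then have "(v n y - K) / real n \<le> \<mu>"
      unfolding \<mu>_def using B_bdd by (rule cSup_upper)
    ultimately show ?thesis using False by (simp add: field_simps abs_le_iff)
  qed (use K in \<open>simp add: v_def\<close>)
  then show thesis using that unfolding v_def by blast
qed

lemma min_plus_eigenvector_exists:
  "\<exists>\<mu> u. \<forall>y\<in>G. u y + \<mu> = min_plus G c u y"
proof -
  obtain \<mu> K where K: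
    "\<And>n y. y \<in> G \<Longrightarrow> \<bar>(min_plus G c ^^ n) (\<lambda>_. 0) y - real n * \<mu>\<bar> \<le> K"
    using min_plus_growth_rate by blast
  define s where "s n y = (min_plus G c ^^ n) (\<lambda>_. 0) y - real n * \<mu>" for n y
  have s: "- K \<le> s n y" "s n y \<le> K" if "y \<in> G" for n y
    using K[OF that, of n] unfolding s_def by linarith+
  \<comment> \<open>Tail infima of the normalised iterates; they increase in \<open>n\<close>, and
    their limit is the lower limit.\<close>
  define w where "w n y = (INF k. s (n + k) y)" for n y
  have le_w_iff: "a \<le> w n y \<longleftrightarrow> (\<forall>k. a \<le> s (n + k) y)" if "y \<in> G" for a n y
    unfolding w_def using s(1)[OF that] by (subst le_cINF_iff) (auto intro: bdd_belowI[of _ "- K"])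
  have w_le_s: "w n y \<le> s (n + k) y" if "y \<in> G" for n k y
    using le_w_iff[OF that] by blast
  have "incseq (\<lambda>n. w n y)" if "y \<in> G" for y
  proof (rule incseq_SucI)
    fix n
    show "w n y \<le> w (Suc n) y"
      unfolding le_w_iff[OF that] using w_le_s[OF that, of n "Suc _"] by simp
  qed
  moreover have "w n y \<le> K" if "y \<in> G" for n y
    using w_le_s[OF that, of n 0] s(2)[OF that, of n] by simp
  ultimately have "\<exists>l. (\<lambda>n. w n y) \<longlonglongrightarrow> l" if "y \<in> G" for y
    using that incseq_convergent by metis
  then obtain u where u: "\<And>y. y \<in> G \<Longrightarrow> (\<lambda>n. w n y) \<longlonglongrightarrow> u y"
    by metis
  \<comment> \<open>The operator commutes with the infimum over the tail and moves the tail by one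
    index. Equality is obtained by showing that both sides have the same lower bounds
    \<open>a\<close>, which reduces it to exchanging two universal quantifiers.\<close>
  have min_plus_w: "min_plus G c (w n) y = w (Suc n) y + \<mu>" if "y \<in> G" for n y
  proof -
    have s_Suc: "s (Suc m) y = min_plus G c (s m) y - \<mu>" for m
    proof -
      have "min_plus G c (s m) y = min_plus G c ((min_plus G c ^^ m) (\<lambda>_. 0)) y - real m * \<mu>"
        by (rule antisym)
           (use min_plus_mono_shift[of "s m" "(min_plus G c ^^ m) (\<lambda>_. 0)" "- real m * \<mu>" y]
              min_plus_mono_shift[of "(min_plus G c ^^ m) (\<lambda>_. 0)" "s m" "real m * \<mu>" y]
             in \<open>simp_all add: s_def\<close>)
      then show ?thesis by (simp add: s_def algebra_simps)
    qed
    have "a \<le> min_plus G c (w n) y \<longleftrightarrow> a \<le> w (Suc n) y + \<mu>" for a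
    proof -
      have "a \<le> min_plus G c (w n) y \<longleftrightarrow> (\<forall>x\<in>G. a - c x y \<le> w n x)"
        by (auto simp: le_min_plus_iff algebra_simps)
      also have "\<dots> \<longleftrightarrow> (\<forall>k. \<forall>x\<in>G. a - c x y \<le> s (n + k) x)"
        by (auto simp: le_w_iff)
      also have "\<dots> \<longleftrightarrow> (\<forall>k. a \<le> min_plus G c (s (n + k)) y)"
        by (auto simp: le_min_plus_iff algebra_simps)
      also have "\<dots> \<longleftrightarrow> (\<forall>k. a - \<mu> \<le> s (Suc n + k) y)"
        by (simp add: s_Suc)
      also have "\<dots> \<longleftrightarrow> a - \<mu> \<le> w (Suc n) y"
        using le_w_iff[OF that] by blast
      finally show ?thesis by (simp add: algebra_simps)
    qed
    then show ?thesis by (meson order_antisym order_refl)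
  qed
  \<comment> \<open>The sequence has two descriptions of its limit: by \<open>min_plus_w\<close>
    through the shifted tail infima, and by continuity of a finite minimum.\<close>
  have "u y + \<mu> = min_plus G c u y" if "y \<in> G" for y
  proof (rule LIMSEQ_unique)
    show "(\<lambda>n. min_plus G c (w n) y) \<longlonglongrightarrow> u y + \<mu>"
      unfolding min_plus_w[OF that] using u[OF that] by (intro tendsto_intros LIMSEQ_Suc)
    show "(\<lambda>n. min_plus G c (w n) y) \<longlonglongrightarrow> min_plus G c u y"
      by (rule min_plus_tendsto) (rule u)
  qed
  then show ?thesis by blast
qed

end

section \<open>The Lax--Oleinik operator in min-plus form\<close>

lemma zero_in_grid: "0 \<in> grid h"
  by (auto simp: grid_def intro!: exI[of _ "0::nat"])

lemma lax_oleinik_le: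
  assumes "tonelli_lagrangian L" "mesh_size h" "\<tau> > 0" "x \<in> grid h" "l \<in> int_vectors"
  shows "lax_oleinik L h \<tau> u y \<le> u x + \<tau> * L x ((y + l - x) /\<^sub>R \<tau>)"
  using lax_oleinik_attained[OF assms(1-3), of u y] assms(4,5) by fastforce

text \<open>The infimum over pairs is taken in two stages: minimising over the lattice translates
  \<open>l\<close> first absorbs them into a cost between grid points.\<close>

lemma lax_oleinik_eq_min_plus:
  fixes L :: "real ^ 'n \<Rightarrow> real ^ 'n \<Rightarrow> real"
  assumes L: "tonelli_lagrangian L" "mesh_size h" "\<tau> > 0"
  shows "lax_oleinik L h \<tau> =
    min_plus (grid h) (\<lambda>x y. INF l\<in>int_vectors. \<tau> * L x ((y + l - x) /\<^sub>R \<tau>))"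
    (is "_ = min_plus _ ?c")
proof (intro ext antisym)
  fix u and y :: "real ^ 'n"
  have G: "finite (grid h :: (real ^ 'n) set)" "(grid h :: (real ^ 'n) set) \<noteq> {}"
    using finite_grid[OF L(2)] zero_in_grid by auto
  have Z: "(int_vectors :: (real ^ 'n) set) \<noteq> {}"
    by (auto simp: int_vectors_def intro!: exI[of _ 0])
  show "lax_oleinik L h \<tau> u y \<le> min_plus (grid h) ?c u y"
    unfolding le_min_plus_iff[OF G]
  proof
    fix x :: "real ^ 'n" assume "x \<in> grid h"
    then have "lax_oleinik L h \<tau> u y - u x \<le> ?c x y"
      using lax_oleinik_le[OF L, of x _ u y] by (intro cINF_greatest Z) (simp add: algebra_simps)
    then show "lax_oleinik L h \<tau> u y \<le> u x + ?c x y" by simp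
  qed
  obtain x l where x: "x \<in> grid h" "l \<in> int_vectors"
    "lax_oleinik L h \<tau> u y = u x + \<tau> * L x ((y + l - x) /\<^sub>R \<tau>)"
    using lax_oleinik_attained[OF L, of u y] by blast
  \<comment> \<open>Without a lower bound the inner infimum would be an unspecified value; the
    attained minimum over all pairs supplies one.\<close>
  have "bdd_below ((\<lambda>l. \<tau> * L x ((y + l - x) /\<^sub>R \<tau>)) ` int_vectors)"
    by (rule bdd_belowI2[of _ "lax_oleinik L h \<tau> u y - u x"])
       (use lax_oleinik_le[OF L x(1), of _ u y] in \<open>simp add: algebra_simps\<close>)
  then have "?c x y \<le> \<tau> * L x ((y + l - x) /\<^sub>R \<tau>)"
    using x(2) by (rule cINF_lower)
  with min_plus_le[OF G x(1), of ?c u y] x(3)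
  show "min_plus (grid h) ?c u y \<le> lax_oleinik L h \<tau> u y" by linarith
qed

theorem proposition3p1:
  fixes L :: "real ^ 'n \<Rightarrow> real ^ 'n \<Rightarrow> real" and h \<tau> :: real
  assumes "tonelli_lagrangian L" and "mesh_size h" and "\<tau> > 0"
  shows "\<exists>Lbar. (\<exists>u. discrete_solution L h \<tau> Lbar u) \<and>
           (\<forall>c u. discrete_solution L h \<tau> c u \<longrightarrow> c = Lbar) \<and>
           (INF (x, v). L x v) \<le> Lbar \<and>
           Lbar \<le> (SUP x. L x 0)"
proof -
  define G :: "(real ^ 'n) set" where "G = grid h"
  have G: "finite G" "G \<noteq> {}"
    using finite_grid[OF assms(2)] zero_in_grid by (auto simp: G_def)
  obtain c where c: "lax_oleinik L h \<tau> = min_plus G c"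
    using lax_oleinik_eq_min_plus[OF assms] unfolding G_def by blast
  have solution_iff: "discrete_solution L h \<tau> a u \<longleftrightarrow> (\<forall>y\<in>G. u y + \<tau> * a = min_plus G c u y)" for a u
    unfolding discrete_solution_def c G_def ..
  obtain \<mu> u where "\<forall>y\<in>G. u y + \<mu> = min_plus G c u y"
    using min_plus_eigenvector_exists[OF G, of c] by blast
  \<comment> \<open>The additive eigenvalue is the cost of one time step of length \<tau>, hence the
    division.\<close>
  then have u: "discrete_solution L h \<tau> (\<mu> / \<tau>) u"
    using \<open>\<tau> > 0\<close> by (simp add: solution_iff)
  \<comment> \<open>Solutions are both subsolutions and supersolutions, so applying this in both
    directions yields uniqueness.\<close>
  have le: "a \<le> b" if "discrete_solution L h \<tau> a u" "discrete_solution L h \<tau> b u'" for a b u u'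
  proof -
    have "\<tau> * a \<le> \<tau> * b"
      by (rule min_plus_comparison[OF G, of u _ c u']) (use that in \<open>auto simp: solution_iff\<close>)
    with \<open>\<tau> > 0\<close> show ?thesis by simp
  qed
  \<comment> \<open>The zero function is a subsolution at rate \<open>INF (x, v). L x v\<close>,
    because one step costs at least \<tau> times that infimum; it is compared with the solution
    \<open>u\<close>.\<close>
  have "\<tau> * (INF (x, v). L x v) \<le> \<tau> * (\<mu> / \<tau>)"
  proof (rule min_plus_comparison[OF G, of "\<lambda>_. 0" _ c u])
    fix y :: "real ^ 'n"
    obtain x l where "lax_oleinik L h \<tau> (\<lambda>_. 0) y = \<tau> * L x ((y + l - x) /\<^sub>R \<tau>)"
      using lax_oleinik_attained[OF assms, of "\<lambda>_. 0" y] by auto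
    moreover have "(INF (x, v). L x v) \<le> L x v" for x v
      using cINF_lower[OF tonelli_lagrangian_bdd_below[OF assms(1)], of "(x, v)"] by simp
    ultimately show "0 + \<tau> * (INF (x, v). L x v) \<le> min_plus G c (\<lambda>_. 0) y"
      using \<open>\<tau> > 0\<close> unfolding c by simp
  qed (use u in \<open>simp add: solution_iff\<close>)
  then have lower: "(INF (x, v). L x v) \<le> \<mu> / \<tau>"
    using \<open>\<tau> > 0\<close> by (simp only: mult_le_cancel_left_pos)
  \<comment> \<open>For the upper bound the grid point 0 is tested with the competitor that stays
    there (\<open>x = 0\<close>, \<open>l = 0\<close>), which has velocity zero.\<close>
  have "u 0 + \<tau> * (\<mu> / \<tau>) = lax_oleinik L h \<tau> u 0"
    using u zero_in_grid unfolding discrete_solution_def by blast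
  also have "\<dots> \<le> u 0 + \<tau> * L 0 ((0 + 0 - 0) /\<^sub>R \<tau>)"
    by (rule lax_oleinik_le[OF assms zero_in_grid]) (simp add: int_vectors_def)
  finally have "\<tau> * (\<mu> / \<tau>) \<le> \<tau> * L 0 0"
    by (simp del: times_divide_eq_right)
  then have "\<mu> / \<tau> \<le> L 0 0"
    using \<open>\<tau> > 0\<close> by (simp only: mult_le_cancel_left_pos)
  \<comment> \<open>The maximum of \<open>L x 0\<close> bounds the range, so that the supremum is
    genuine.\<close>
  moreover have "L 0 0 \<le> (SUP x. L x 0)"
    using tonelli_lagrangian_zero_max[OF assms(1)] by (auto intro!: cSUP_upper simp: bdd_above_def)
  ultimately show ?thesis
    using u lower le[OF u] le[OF _ u] by (intro exI[of _ "\<mu> / \<tau>"]) (auto intro!: antisym)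
qed

end
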